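(* Let $F$ be a driver such that the following two assumptions hold: (i) for any adapted $Y$ and any adapted $Z^1,Z^2$ with $Z^1\sim_M Z^2$, one has $F(\omega,t,Y_t,Z^1_t)=F(\omega,t,Y_t,Z^2_t)$ $\mathbb{P}$-a.s. for all $t\in\{0,\dots,T-1\}$; (ii) for any adapted $Z$ and all $t\in\{0,\dots,T-1\}$, the map $Y_t\mapsto Y_t-F(\omega,t,Y_t,Z_t)$ is $\mathbb{P}$-a.s. a bijection from $\mathbb{R}^K$ to $\mathbb{R}^K$, up to equality $\mathbb{P}$-a.s. Then for any essentially bounded, $\mathcal{F}_T$-measurable, $\mathbb{R}^K$-valued terminal condition $Q$, the backward stochastic difference equation $$Y_t-\sum_{t\le u<T}F(\omega,u,Y_u,Z_u)+\sum_{t\le u<T}Z_uM_{u+1}=Q,\qquad t\in\{0,\dots,T\},$$ has an adapted solution $(Y,Z)$. Moreover, this solution is unique up to indistinguishability for $Y$ and up to the equivalence $\sim_M$ for $Z$.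
   Context: Setting. $N,K\ge 1$ are integers and $T\geq 1$ is a deterministic integer. $X=(X_t)_{0\le t\le T}$ is a process on a probability space $(\Omega,\mathcal{F},\mathbb{P})$ with values in the standard basis (column) vectors $\{e_1,\dots,e_N\}$ of $\mathbb{R}^N$, and $\mathcal{F}_t$ is the completion of the $\sigma$-algebra generated by $X_0,\dots,X_t$. Put $M_t:=X_t-E[X_t\mid\mathcal{F}_{t-1}]$ for $1\le t\le T$. Random variables equal $\mathbb{P}$-a.s. are identified in $L^\infty(\mathcal{F}_t)$; since $X$ has finitely many paths, $L^1(\mathcal{F}_t)=L^2(\mathcal{F}_t)=L^\infty(\mathcal{F}_t)$. Driver. A driver is an adapted map $F:\Omega\times\{0,\dots,T\}\times\mathbb{R}^K\times\mathbb{R}^{K\times N}\to\mathbb{R}^K$ such that $F(\omega,t,Y_t,Z_t)\in L^\infty(\mathcal{F}_t)$ for all $t$ and all $Y_t,Z_t\in L^\infty(\mathcal{F}_t)$ (with values in $\mathbb{R}^K$, $\mathbb{R}^{K\times N}$). Adapted processes and solutions. All adapted processes $Y$ ($\mathbb{R}^K$-valued) and $Z$ ($\mathbb{R}^{K\times N}$-valued) have $Y_t,Z_t\in L^\infty(\mathcal{F}_t)$; in particular a solution $(Y,Z)$ is adapted in this sense, and the equation holds $\mathbb{P}$-a.s. for every $t$ (only $Z_0,\dots,Z_{T-1}$ matter). Equivalence. $Z^1\sim_M Z^2$ means $Z^1_uM_{u+1}=Z^2_uM_{u+1}$ $\mathbb{P}$-a.s. for all $u\in\{0,\dots,T-1\}$.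 Convention for (ii): "$\mathbb{P}$-a.s. a bijection, up to equality $\mathbb{P}$-a.s." means that for each $Z_t\in L^\infty(\mathcal{F}_t)$ the map $Y_t\mapsto Y_t-F(\omega,t,Y_t,Z_t)$ is a bijection of the set of $\mathbb{R}^K$-valued $\mathcal{F}_t$-measurable random variables (identified when $\mathbb{P}$-a.s. equal) onto itself. *)

theory Defs
  imports "HOL-Probability.Probability"
begin

text \<open>
  The completed natural filtration of \<open>X\<close>: the history \<open>\<sigma>(X\<^sub>0, \<dots>, X\<^sub>t)\<close> together with all
  \<open>P\<close>-null sets. The null sets are those of \<open>completion P\<close> since \<open>P\<close> itself is not assumed
  to be complete; the resulting \<open>\<sigma>\<close>-algebra is contained in \<open>completion P\<close>, but in general
  not in \<open>P\<close>. Measurability with respect to it is invariant under \<open>P\<close>-a.s. equality.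
\<close>

definition hist_filtration ::
    "'w measure \<Rightarrow> (nat \<Rightarrow> 'w \<Rightarrow> real ^ 'n) \<Rightarrow> nat \<Rightarrow> 'w measure" where
  "hist_filtration P X t =
     sigma (space P)
       ({X s -` A \<inter> space P | s A. s \<le> t \<and> A \<in> sets borel} \<union> null_sets (completion P))"

text \<open>
  The martingale difference \<open>M\<^sub>t = X\<^sub>t - E[X\<^sub>t | F\<^sub>t\<^sub>-\<^sub>1]\<close>, meaningful for \<open>t \<ge> 1\<close> only; the
  conditional expectation of the vector \<open>X\<^sub>t\<close> is taken componentwise.
\<close>

definition mart_diff ::
    "'w measure \<Rightarrow> (nat \<Rightarrow> 'w \<Rightarrow> real ^ 'n) \<Rightarrow> nat \<Rightarrow> 'w \<Rightarrow> real ^ 'n" where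
  "mart_diff P X t \<omega> =
     X t \<omega> - (\<chi> i. real_cond_exp (completion P) (hist_filtration P X (t - 1))
                       (\<lambda>\<omega>. X t \<omega> $ i) \<omega>)"

definition Linf :: "'w measure \<Rightarrow> 'w measure \<Rightarrow> ('w \<Rightarrow> 'b::real_normed_vector) set" where
  "Linf P G = {f \<in> borel_measurable G. \<exists>C. AE \<omega> in P. norm (f \<omega>) \<le> C}"

definition adapted_proc ::
    "'w measure \<Rightarrow> (nat \<Rightarrow> 'w \<Rightarrow> real ^ 'n) \<Rightarrow> nat \<Rightarrow>
     (nat \<Rightarrow> 'w \<Rightarrow> 'b::real_normed_vector) \<Rightarrow> bool" where
  "adapted_proc P X T V \<longleftrightarrow> (\<forall>t\<le>T. V t \<in> Linf P (hist_filtration P X t))"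

definition driver ::
    "'w measure \<Rightarrow> (nat \<Rightarrow> 'w \<Rightarrow> real ^ 'n) \<Rightarrow> nat \<Rightarrow>
     ('w \<Rightarrow> nat \<Rightarrow> real ^ 'k \<Rightarrow> real ^ 'n ^ 'k \<Rightarrow> real ^ 'k) \<Rightarrow> bool" where
  "driver P X T F \<longleftrightarrow>
     (\<forall>t\<le>T. \<forall>y \<in> Linf P (hist_filtration P X t). \<forall>z \<in> Linf P (hist_filtration P X t).
        (\<lambda>\<omega>. F \<omega> t (y \<omega>) (z \<omega>)) \<in> Linf P (hist_filtration P X t))"

definition equiv_M ::
    "'w measure \<Rightarrow> (nat \<Rightarrow> 'w \<Rightarrow> real ^ 'n) \<Rightarrow> nat \<Rightarrow>
     (nat \<Rightarrow> 'w \<Rightarrow> real ^ 'n ^ 'k) \<Rightarrow> (nat \<Rightarrow> 'w \<Rightarrow> real ^ 'n ^ 'k) \<Rightarrow> bool" where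
  "equiv_M P X T Z1 Z2 \<longleftrightarrow>
     (\<forall>u<T. AE \<omega> in P. Z1 u \<omega> *v mart_diff P X (u + 1) \<omega> = Z2 u \<omega> *v mart_diff P X (u + 1) \<omega>)"

definition ae_rel :: "'w measure \<Rightarrow> ('w \<Rightarrow> 'b) set \<Rightarrow> (('w \<Rightarrow> 'b) \<times> ('w \<Rightarrow> 'b)) set" where
  "ae_rel P A = {(U, V). U \<in> A \<and> V \<in> A \<and> (AE \<omega> in P. U \<omega> = V \<omega>)}"

text \<open>
  The map induced by \<open>\<Phi>\<close> on the classes of \<open>P\<close>-a.s. equal elements of \<open>A\<close> is a bijection.
  A class \<open>C\<close> is sent to the union of the classes of the \<open>\<Phi> U\<close>, \<open>U \<in> C\<close>; this is a single
  class when \<open>\<Phi>\<close> maps \<open>A\<close> to itself and respects a.s. equality.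
\<close>

definition bij_up_to_ae :: "'w measure \<Rightarrow> ('w \<Rightarrow> 'b) set \<Rightarrow> (('w \<Rightarrow> 'b) \<Rightarrow> ('w \<Rightarrow> 'b)) \<Rightarrow> bool" where
  "bij_up_to_ae P A \<Phi> \<longleftrightarrow>
     bij_betw (\<lambda>C. ae_rel P A `` (\<Phi> ` C)) (A // ae_rel P A) (A // ae_rel P A)"

definition bsde_solution ::
    "'w measure \<Rightarrow> (nat \<Rightarrow> 'w \<Rightarrow> real ^ 'n) \<Rightarrow> nat \<Rightarrow>
     ('w \<Rightarrow> nat \<Rightarrow> real ^ 'k \<Rightarrow> real ^ 'n ^ 'k \<Rightarrow> real ^ 'k) \<Rightarrow> ('w \<Rightarrow> real ^ 'k) \<Rightarrow>
     (nat \<Rightarrow> 'w \<Rightarrow> real ^ 'k) \<Rightarrow> (nat \<Rightarrow> 'w \<Rightarrow> real ^ 'n ^ 'k) \<Rightarrow> bool" where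
  "bsde_solution P X T F Q Y Z \<longleftrightarrow>
     adapted_proc P X T Y \<and> adapted_proc P X T Z \<and>
     (\<forall>t\<le>T. AE \<omega> in P.
        Y t \<omega> - (\<Sum>u\<in>{t..<T}. F \<omega> u (Y u \<omega>) (Z u \<omega>))
              + (\<Sum>u\<in>{t..<T}. Z u \<omega> *v mart_diff P X (u + 1) \<omega>) = Q \<omega>)"

end

theory Submission
  imports Defs
begin

text \<open>
  Because \<open>X\<close> has finitely many paths, \<open>\<F>\<^sub>t\<close>-measurable means a.s. equal to a function of the
  path up to time \<open>t\<close>. Such a function at time \<open>t + 1\<close> depends on \<open>X\<^sub>t\<^sub>+\<^sub>1 \<in> {e\<^sub>1, \<dots>, e\<^sub>N}\<close>
  linearly, so \<open>Y\<^sub>t\<^sub>+\<^sub>1 = H X\<^sub>t\<^sub>+\<^sub>1 = H E[X\<^sub>t\<^sub>+\<^sub>1 | \<F>\<^sub>t] + H M\<^sub>t\<^sub>+\<^sub>1\<close> with an \<open>\<F>\<^sub>t\<close>-measurable matrix \<open>H\<close>.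
  One backward step is therefore solved by \<open>Z\<^sub>t = H\<close> and the \<open>Y\<^sub>t\<close> with
  \<open>Y\<^sub>t - F(t, Y\<^sub>t, H) = H E[X\<^sub>t\<^sub>+\<^sub>1 | \<F>\<^sub>t]\<close>. Conversely, conditioning one step on \<open>\<F>\<^sub>t\<close> separates
  the part \<open>Z\<^sub>t M\<^sub>t\<^sub>+\<^sub>1\<close> from \<open>Y\<^sub>t - F(t, Y\<^sub>t, Z\<^sub>t)\<close>.
\<close>

section \<open>Bijections on classes of almost surely equal functions\<close>

lemma equiv_ae_rel: "equiv A (ae_rel P A)"
  by (rule equivI) (auto simp: ae_rel_def refl_on_def sym_def trans_def elim: eventually_elim2)

text \<open>This brings surjectivity on classes down to functions. The image of a class is a union
  of the classes of the \<open>\<Phi> U\<close>, so \<open>V\<close>, which lies in its own class,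
  lies in the class of one particular \<open>\<Phi> U\<close>.\<close>

lemma bij_up_to_ae_surj:
  assumes bij: "bij_up_to_ae P A \<Phi>"
    and V: "V \<in> A"
  obtains U where "U \<in> A" "AE \<omega> in P. \<Phi> U \<omega> = V \<omega>"
proof -
  have "ae_rel P A `` {V} \<in> A // ae_rel P A"
    using V by (rule quotientI)
  then obtain C where C: "C \<in> A // ae_rel P A" "ae_rel P A `` (\<Phi> ` C) = ae_rel P A `` {V}"
    using bij unfolding bij_up_to_ae_def bij_betw_def by (metis (no_types, lifting) imageE)
  have "V \<in> ae_rel P A `` {V}"
    using V by (auto simp: ae_rel_def)
  then have "V \<in> ae_rel P A `` (\<Phi> ` C)"
    using C(2) by simp
  then obtain U where "U \<in> C" "(\<Phi> U, V) \<in> ae_rel P A"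
    by auto
  moreover from this have "U \<in> A"
    using C(1) in_quotient_imp_subset[OF equiv_ae_rel] by blast
  ultimately show thesis
    using that by (auto simp: ae_rel_def)
qed

text \<open>By \<open>maps\<close> and \<open>cong\<close>, the union that defines the image of the
  class of \<open>W\<close> collapses to the single class of \<open>\<Phi> W\<close>. Injectivity on
  classes can then be tested on representatives.\<close>

lemma bij_up_to_ae_inj:
  assumes bij: "bij_up_to_ae P A \<Phi>"
    and maps: "\<And>U. U \<in> A \<Longrightarrow> \<Phi> U \<in> A"
    and cong: "\<And>U V. U \<in> A \<Longrightarrow> V \<in> A \<Longrightarrow> AE \<omega> in P. U \<omega> = V \<omega> \<Longrightarrow> AE \<omega> in P. \<Phi> U \<omega> = \<Phi> V \<omega>"
    and UV: "U \<in> A" "V \<in> A"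
    and eq: "AE \<omega> in P. \<Phi> U \<omega> = \<Phi> V \<omega>"
  shows "AE \<omega> in P. U \<omega> = V \<omega>"
proof -
  let ?r = "ae_rel P A"
  have image: "?r `` (\<Phi> ` (?r `` {W})) = ?r `` {\<Phi> W}" if W: "W \<in> A" for W
  proof -
    have "?r `` {\<Phi> W'} = ?r `` {\<Phi> W}" if "W' \<in> ?r `` {W}" for W'
    proof -
      have W': "W' \<in> A" "AE \<omega> in P. W \<omega> = W' \<omega>"
        using that by (auto simp: ae_rel_def)
      then have "(\<Phi> W, \<Phi> W') \<in> ?r"
        using cong[OF W W'] maps W by (auto simp: ae_rel_def)
      then show ?thesis
        using equiv_class_eq[OF equiv_ae_rel] by fast
    qed
    moreover have "W \<in> ?r `` {W}"
      using W by (auto simp: ae_rel_def)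
    ultimately show ?thesis by blast
  qed
  have "(\<Phi> U, \<Phi> V) \<in> ?r"
    using eq maps UV by (auto simp: ae_rel_def)
  then have "?r `` {\<Phi> U} = ?r `` {\<Phi> V}"
    by (rule equiv_class_eq[OF equiv_ae_rel])
  then have "?r `` (\<Phi> ` (?r `` {U})) = ?r `` (\<Phi> ` (?r `` {V}))"
    using image UV by simp
  moreover have "inj_on (\<lambda>C. ?r `` (\<Phi> ` C)) (A // ?r)"
    using bij by (auto simp: bij_up_to_ae_def bij_betw_def)
  ultimately have "?r `` {U} = ?r `` {V}"
    using UV by (elim inj_onD) (auto intro: quotientI)
  then have "(U, V) \<in> ?r"
    using UV eq_equiv_class[OF _ equiv_ae_rel] by fast
  then show ?thesis
    by (auto simp: ae_rel_def)
qed

section \<open>Path description of the completed filtration\<close>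

locale basis_process = prob_space P for P :: "'w measure" +
  fixes T :: nat and X :: "nat \<Rightarrow> 'w \<Rightarrow> real ^ 'n"
  assumes X_measurable: "\<And>t. t \<le> T \<Longrightarrow> X t \<in> borel_measurable P"
    and X_basis: "\<And>t \<omega>. t \<le> T \<Longrightarrow> \<omega> \<in> space P \<Longrightarrow> X t \<omega> \<in> range (\<lambda>i. axis i 1)"
begin

abbreviation G :: "nat \<Rightarrow> 'w measure" where
  "G t \<equiv> hist_filtration P X t"

text \<open>Restricting to \<open>{..t}\<close> fixes the values outside, so paths range over a
  finite extensional function space and two of them are equal exactly when they agree up to time
  \<open>t\<close>.\<close>

definition path :: "nat \<Rightarrow> 'w \<Rightarrow> nat \<Rightarrow> real ^ 'n" where
  "path t \<omega> = (\<lambda>s\<in>{..t}. X s \<omega>)"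

lemma finite_paths: "finite ({..t :: nat} \<rightarrow>\<^sub>E range (\<lambda>i. axis i (1 :: real) :: real ^ 'n))"
  by (intro finite_PiE) auto

lemma path_in:
  assumes "t \<le> T" "\<omega> \<in> space P"
  shows "path t \<omega> \<in> {..t} \<rightarrow>\<^sub>E range (\<lambda>i. axis i 1)"
  using X_basis[of _ \<omega>] assms by (auto simp: path_def)

lemma path_Suc: "path (Suc t) \<omega> = (path t \<omega>)(Suc t := X (Suc t) \<omega>)"
  by (auto simp: path_def fun_eq_iff)

lemma history_generators_subset:
  "{X s -` A \<inter> space P | s A. s \<le> t \<and> A \<in> sets borel} \<union> null_sets (completion P) \<subseteq> Pow (space P)"
  using sets.sets_into_space[of _ "completion P"] by (fastforce simp: null_sets_def)

lemma space_G [simp]: "space (G t) = space P"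
  by (simp add: hist_filtration_def space_measure_of_conv)

lemma sets_G:
  "sets (G t) = sigma_sets (space P)
     ({X s -` A \<inter> space P | s A. s \<le> t \<and> A \<in> sets borel} \<union> null_sets (completion P))"
  unfolding hist_filtration_def by (rule sets_measure_of[OF history_generators_subset])

lemma null_sets_in_G: "N \<in> null_sets (completion P) \<Longrightarrow> N \<in> sets (G t)"
  unfolding sets_G by blast

lemma X_measurable_G: "s \<le> t \<Longrightarrow> X s \<in> borel_measurable (G t)"
  by (rule measurableI) (auto simp: sets_G)

lemma sets_G_le:
  assumes "t \<le> T"
  shows "sets (G t) \<subseteq> sets (completion P)"
  unfolding sets_G
proof (rule sets.sigma_sets_subset[of _ "completion P", simplified], safe)
  fix s and A :: "(real ^ 'n) set"
  assume "s \<le> t" "A \<in> sets borel"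
  then show "X s -` A \<inter> space P \<in> sets (completion P)"
    using X_measurable[of s] assms by (auto intro: measurable_sets)
qed (auto simp: null_sets_def)

lemma subalgebra_G: "t \<le> T \<Longrightarrow> subalgebra (completion P) (G t)"
  using sets_G_le by (auto simp: subalgebra_def)

lemma measurable_G_completion:
  "t \<le> T \<Longrightarrow> f \<in> borel_measurable (G t) \<Longrightarrow> f \<in> borel_measurable (completion P)"
  using measurable_from_subalg[OF subalgebra_G] .

text \<open>Each path event is a finite intersection of events \<open>X s = p s\<close>. With
  \<open>count_space\<close> as target, every function of the path becomes measurable.\<close>

lemma path_measurable:
  assumes "t \<le> T"
  shows "path t \<in> measurable (G t) (count_space ({..t} \<rightarrow>\<^sub>E range (\<lambda>i. axis i 1)))"
  unfolding measurable_count_space_eq2[OF finite_paths]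
proof (intro conjI Pi_I ballI)
  show "path t \<omega> \<in> {..t} \<rightarrow>\<^sub>E range (\<lambda>i. axis i 1)" if "\<omega> \<in> space (G t)" for \<omega>
    using path_in assms that by simp
next
  fix p :: "nat \<Rightarrow> real ^ 'n" assume p: "p \<in> {..t} \<rightarrow>\<^sub>E range (\<lambda>i. axis i 1)"
  have "path t \<omega> = p \<longleftrightarrow> (\<forall>s\<le>t. X s \<omega> = p s)" for \<omega>
    using p by (auto simp: path_def fun_eq_iff PiE_def extensional_def)
  then have "path t -` {p} \<inter> space (G t) = (\<Inter>s\<in>{..t}. X s -` {p s} \<inter> space (G t))"
    by auto
  also have "\<dots> \<in> sets (G t)"
    by (intro sets.finite_INT measurable_sets[OF X_measurable_G]) auto
  finally show "path t -` {p} \<inter> space (G t) \<in> sets (G t)" .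
qed

text \<open>Induction over the generated \<sigma>-algebra: a generator from the history is visible
  on the path, a null set is matched by \<open>{}\<close>, and the property passes to complements
  and countable unions.\<close>

lemma sets_G_path:
  assumes "t \<le> T" "B \<in> sets (G t)"
  shows "\<exists>S. AE \<omega> in P. \<omega> \<in> B \<longleftrightarrow> path t \<omega> \<in> S"
  using assms(2) unfolding sets_G
proof (induction rule: sigma_sets.induct)
  case (Basic B)
  then consider (hist) s A where "s \<le> t" "B = X s -` A \<inter> space P"
    | (null) "B \<in> null_sets (completion P)"
    by auto
  then show ?case
  proof cases
    case hist
    then show ?thesis
      by (intro exI[of _ "{p. p s \<in> A}"] AE_I2) (auto simp: path_def)
  next
    case null
    then have "AE \<omega> in P. \<omega> \<notin> B"
      using AE_not_in AE_completion_iff by blast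
    then show ?thesis
      by (intro exI[of _ "{}"]) simp
  qed
next
  case Empty
  show ?case by (intro exI[of _ "{}"]) simp
next
  case (Compl B)
  then obtain S where S: "AE \<omega> in P. \<omega> \<in> B \<longleftrightarrow> path t \<omega> \<in> S" by blast
  have "AE \<omega> in P. \<omega> \<in> space P - B \<longleftrightarrow> path t \<omega> \<in> - S"
    using S AE_space by eventually_elim auto
  then show ?case by blast
next
  case (Union B)
  then obtain S where "AE \<omega> in P. \<omega> \<in> B i \<longleftrightarrow> path t \<omega> \<in> S i" for i :: nat
    by metis
  then have "AE \<omega> in P. \<forall>i. \<omega> \<in> B i \<longleftrightarrow> path t \<omega> \<in> S i"
    by (simp add: AE_all_countable)
  then have "AE \<omega> in P. \<omega> \<in> (\<Union>i. B i) \<longleftrightarrow> path t \<omega> \<in> (\<Union>i. S i)"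
    by eventually_elim auto
  then show ?case by blast
qed

text \<open>A Doob-Dynkin factorization up to null sets. A countable basis gives one null set
  outside which the path decides membership of \<open>f \<omega>\<close> in every basic open set.
  Separation of points then makes \<open>f\<close> constant along each path.\<close>

lemma measurable_G_imp_path:
  fixes f :: "'w \<Rightarrow> 'b :: {second_countable_topology, t0_space}"
  assumes "t \<le> T" and f: "f \<in> borel_measurable (G t)"
  obtains g where "AE \<omega> in P. f \<omega> = g (path t \<omega>)"
proof -
  obtain B :: "'b set set" where B: "countable B" "topological_basis B"
    using ex_countable_basis by blast
  have "\<exists>S. AE \<omega> in P. f \<omega> \<in> U \<longleftrightarrow> path t \<omega> \<in> S" if "U \<in> B" for U
  proof -
    have "f -` U \<inter> space (G t) \<in> sets (G t)"
      using B(2) that by (intro measurable_sets[OF f] borel_open) (rule topological_basis_open)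
    then obtain S where "AE \<omega> in P. \<omega> \<in> f -` U \<inter> space (G t) \<longleftrightarrow> path t \<omega> \<in> S"
      using sets_G_path assms(1) by blast
    then have "AE \<omega> in P. f \<omega> \<in> U \<longleftrightarrow> path t \<omega> \<in> S"
      using AE_space by eventually_elim auto
    then show ?thesis by blast
  qed
  then obtain S where "\<And>U. U \<in> B \<Longrightarrow> AE \<omega> in P. f \<omega> \<in> U \<longleftrightarrow> path t \<omega> \<in> S U"
    by metis
  then have ae: "AE \<omega> in P. \<forall>U\<in>B. f \<omega> \<in> U \<longleftrightarrow> path t \<omega> \<in> S U"
    using B(1) by (simp add: AE_ball_countable)
  define good where "good \<omega> \<longleftrightarrow> (\<forall>U\<in>B. f \<omega> \<in> U \<longleftrightarrow> path t \<omega> \<in> S U)" for \<omega>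
  have separated: "f \<omega> = f \<omega>'" if "good \<omega>" "good \<omega>'" "path t \<omega> = path t \<omega>'" for \<omega> \<omega>'
  proof (rule ccontr)
    assume "f \<omega> \<noteq> f \<omega>'"
    then obtain V where V: "open V" "f \<omega> \<in> V \<longleftrightarrow> f \<omega>' \<notin> V"
      by (metis separation_t0)
    obtain B' where "B' \<subseteq> B" "\<Union>B' = V"
      using B(2) V(1) by (auto simp: topological_basis_def)
    then show False
      using that V(2) by (auto simp: good_def)
  qed
  \<comment> \<open>The factor takes its value at a chosen good sample point with the given path.
    Its value on paths without such a point is arbitrary, and no good \<omega> ever meets
    it.\<close>
  define g where "g p = f (SOME \<omega>. good \<omega> \<and> path t \<omega> = p)" for p
  have "f \<omega> = g (path t \<omega>)" if "good \<omega>" for \<omega>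
  proof -
    let ?c = "SOME \<omega>'. good \<omega>' \<and> path t \<omega>' = path t \<omega>"
    have "good ?c \<and> path t ?c = path t \<omega>"
      by (rule someI[of _ \<omega>]) (use that in simp)
    then show ?thesis
      unfolding g_def using separated that by metis
  qed
  then have "AE \<omega> in P. f \<omega> = g (path t \<omega>)"
    using ae by (auto simp: good_def)
  then show thesis by (rule that)
qed

text \<open>The converse factorization rests on completeness: every subset of a null set belongs to
  the filtration, so changing a function of the path on a null set keeps it measurable.\<close>

lemma measurable_G_ae_eq_path:
  fixes f :: "'w \<Rightarrow> 'b :: topological_space"
  assumes "t \<le> T" and ae: "AE \<omega> in P. f \<omega> = g (path t \<omega>)"
  shows "f \<in> borel_measurable (G t)"
proof (rule measurableI)
  fix A :: "'b set" assume A: "A \<in> sets borel"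
  obtain N where N: "N \<in> null_sets P" "{\<omega> \<in> space P. f \<omega> \<noteq> g (path t \<omega>)} \<subseteq> N"
    using ae by (auto simp: eventually_ae_filter)
  have null: "C \<in> sets (G t)" if "C \<subseteq> N" for C
    using null_sets_completion_subset[OF that null_sets_completionI[OF N(1)]] by (rule null_sets_in_G)
  have "(\<lambda>\<omega>. g (path t \<omega>)) \<in> borel_measurable (G t)"
    by (rule measurable_compose[OF path_measurable[OF assms(1)]]) simp
  then have path: "(\<lambda>\<omega>. g (path t \<omega>)) -` A \<inter> space (G t) \<in> sets (G t)"
    using A by (rule measurable_sets)
  \<comment> \<open>Outside \<open>N\<close> the preimage is that of the function of the path; what
    remains lies inside \<open>N\<close> and is null.\<close>
  have "f -` A \<inter> space (G t) =
      ((\<lambda>\<omega>. g (path t \<omega>)) -` A \<inter> space (G t) - N) \<union> (f -` A \<inter> space P \<inter> N)"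
    using N(2) by auto
  also have "\<dots> \<in> sets (G t)"
    using path null by (intro sets.Un sets.Diff) auto
  finally show "f -` A \<inter> space (G t) \<in> sets (G t)" .
qed simp

text \<open>A function of finitely many paths is bounded by the maximum of its norms over them.
  Adaptedness thereby reduces to measurability at each time.\<close>

lemma Linf_eq_measurable:
  assumes "t \<le> T"
  shows "Linf P (G t) = (borel_measurable (G t) :: ('w \<Rightarrow> 'b :: euclidean_space) set)"
proof -
  have "\<exists>C. AE \<omega> in P. norm (f \<omega>) \<le> C" if f: "f \<in> borel_measurable (G t)" for f :: "'w \<Rightarrow> 'b"
  proof -
    obtain g where g: "AE \<omega> in P. f \<omega> = g (path t \<omega>)"
      using measurable_G_imp_path[OF assms f] .
    let ?C = "Max ((\<lambda>p. norm (g p)) ` ({..t} \<rightarrow>\<^sub>E range (\<lambda>i. axis i 1)))"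
    have "AE \<omega> in P. norm (f \<omega>) \<le> ?C"
      using g AE_space
    proof eventually_elim
      case (elim \<omega>)
      then show ?case
        using path_in[OF assms, of \<omega>] finite_paths by (auto intro!: Max_ge)
    qed
    then show ?thesis ..
  qed
  then show ?thesis
    by (auto simp: Linf_def)
qed

text \<open>Almost surely both arguments are functions of the path, hence so is their combination
  under an arbitrary \<open>h\<close>. This supplies measurability of matrix-vector products and of
  components.\<close>

lemma measurable_G_compose2:
  fixes f :: "'w \<Rightarrow> 'b :: {second_countable_topology, t0_space}"
    and g :: "'w \<Rightarrow> 'c :: {second_countable_topology, t0_space}"
    and h :: "'b \<Rightarrow> 'c \<Rightarrow> 'd :: topological_space"
  assumes "t \<le> T" "f \<in> borel_measurable (G t)" "g \<in> borel_measurable (G t)"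
  shows "(\<lambda>\<omega>. h (f \<omega>) (g \<omega>)) \<in> borel_measurable (G t)"
proof -
  obtain f' where f': "AE \<omega> in P. f \<omega> = f' (path t \<omega>)"
    using measurable_G_imp_path[OF assms(1,2)] .
  obtain g' where g': "AE \<omega> in P. g \<omega> = g' (path t \<omega>)"
    using measurable_G_imp_path[OF assms(1,3)] .
  have "AE \<omega> in P. h (f \<omega>) (g \<omega>) = (\<lambda>p. h (f' p) (g' p)) (path t \<omega>)"
    using f' g' by eventually_elim simp
  then show ?thesis
    by (rule measurable_G_ae_eq_path[OF assms(1)])
qed

section \<open>Conditional expectations and martingale differences\<close>

definition cond_X :: "nat \<Rightarrow> 'w \<Rightarrow> real ^ 'n" where
  "cond_X t \<omega> = (\<chi> i. real_cond_exp (completion P) (G t) (\<lambda>\<omega>. X (Suc t) \<omega> $ i) \<omega>)"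

lemma mart_diff_Suc: "mart_diff P X (Suc t) \<omega> = X (Suc t) \<omega> - cond_X t \<omega>"
  by (simp add: mart_diff_def cond_X_def)

lemma cond_X_measurable:
  assumes "t \<le> T"
  shows "cond_X t \<in> borel_measurable (G t)"
proof -
  have "\<exists>g. AE \<omega> in P. cond_X t \<omega> $ i = g (path t \<omega>)" for i
  proof -
    have "(\<lambda>\<omega>. cond_X t \<omega> $ i) \<in> borel_measurable (G t)"
      by (simp add: cond_X_def)
    then show ?thesis
      using measurable_G_imp_path[OF assms] by blast
  qed
  then obtain g where "\<And>i. AE \<omega> in P. cond_X t \<omega> $ i = g i (path t \<omega>)"
    by metis
  then have "AE \<omega> in P. \<forall>i. cond_X t \<omega> $ i = g i (path t \<omega>)"
    by (simp add: AE_all_countable)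
  then have "AE \<omega> in P. cond_X t \<omega> = (\<lambda>p. \<chi> i. g i p) (path t \<omega>)"
    by eventually_elim (simp add: vec_eq_iff)
  then show ?thesis
    by (rule measurable_G_ae_eq_path[OF assms])
qed

text \<open>Column \<open>i\<close> of \<open>H\<close> is the value that \<open>W\<close> takes
  when the path up to \<open>t\<close> is continued by the basis vector \<open>axis i 1\<close>.
  Multiplying by \<open>X (Suc t)\<close> selects the column of the continuation that
  occurs.\<close>

lemma measurable_G_Suc_linear:
  fixes W :: "'w \<Rightarrow> real ^ 'k"
  assumes "Suc t \<le> T" "W \<in> borel_measurable (G (Suc t))"
  obtains H :: "'w \<Rightarrow> real ^ 'n ^ 'k"
  where "H \<in> borel_measurable (G t)" "AE \<omega> in P. W \<omega> = H \<omega> *v X (Suc t) \<omega>"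
proof -
  obtain g where g: "AE \<omega> in P. W \<omega> = g (path (Suc t) \<omega>)"
    using measurable_G_imp_path[OF assms] .
  define h :: "(nat \<Rightarrow> real ^ 'n) \<Rightarrow> real ^ 'n ^ 'k"
    where "h p = (\<chi> k i. g (p(Suc t := axis i 1)) $ k)" for p
  have "(\<lambda>\<omega>. h (path t \<omega>)) \<in> borel_measurable (G t)"
    using assms(1) by (intro measurable_G_ae_eq_path[where g = h]) auto
  moreover have "AE \<omega> in P. W \<omega> = h (path t \<omega>) *v X (Suc t) \<omega>"
    using g AE_space
  proof eventually_elim
    case (elim \<omega>)
    obtain i where i: "X (Suc t) \<omega> = axis i 1"
      using X_basis[OF assms(1) elim(2)] by auto
    have "h (path t \<omega>) *v axis i 1 = g ((path t \<omega>)(Suc t := axis i 1))"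
      by (simp add: matrix_vector_mult_basis column_def h_def vec_eq_iff)
    then show ?case
      using elim(1) i by (simp add: path_Suc)
  qed
  ultimately show thesis by (rule that)
qed

text \<open>Conditioning on \<open>G t\<close> removes the martingale difference term and leaves
  \<open>A\<close>, which is already \<open>G t\<close>-measurable. The computation is done row by
  row because the conditional expectation is real-valued.\<close>

lemma mart_diff_separation:
  fixes A :: "'w \<Rightarrow> real ^ 'k" and D :: "'w \<Rightarrow> real ^ 'n ^ 'k"
  assumes t: "t < T" and A: "A \<in> borel_measurable (G t)" and D: "D \<in> borel_measurable (G t)"
    and ae: "AE \<omega> in P. A \<omega> + D \<omega> *v mart_diff P X (t + 1) \<omega> = 0"
  shows "AE \<omega> in P. A \<omega> = 0"
proof -
  \<comment> \<open>\<open>G t\<close> contains the null sets of the completion, so it is used as a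
    subalgebra of \<open>completion P\<close>; almost sure statements are transferred between the
    two measures.\<close>
  interpret CP: prob_space "completion P"
    by (rule prob_space_completion)
  interpret CE: finite_measure_subalgebra "completion P" "G t"
    using subalgebra_G t by unfold_locales auto
  have bounded: "\<exists>C. AE \<omega> in completion P. norm (f \<omega>) \<le> C"
    if "s \<le> T" "f \<in> borel_measurable (G s)" for s and f :: "'w \<Rightarrow> real"
    using Linf_eq_measurable[OF that(1), where 'b = real] that(2)
    by (auto simp: Linf_def AE_completion_iff)
  have integrable: "integrable (completion P) f"
    if s: "s \<le> T" "f \<in> borel_measurable (G s)" for s and f :: "'w \<Rightarrow> real"
    using bounded[OF that] CP.integrable_const_bound measurable_G_completion[OF that] by blast
  \<comment> \<open>Monotonicity of the filtration is read off from paths: the path up to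
    \<open>t\<close> is a restriction of the path up to \<open>Suc t\<close>.\<close>
  have G_mono: "f \<in> borel_measurable (G (Suc t))" if f: "f \<in> borel_measurable (G t)" for f :: "'w \<Rightarrow> real"
  proof -
    obtain g where g: "AE \<omega> in P. f \<omega> = g (path t \<omega>)"
      using measurable_G_imp_path[OF _ f] t by auto
    have "path t \<omega> = restrict (path (Suc t) \<omega>) {..t}" for \<omega>
      by (auto simp: path_def fun_eq_iff)
    then show ?thesis
      using g t measurable_G_ae_eq_path[of "Suc t" f "\<lambda>p. g (restrict p {..t})"] by simp
  qed
  have "AE \<omega> in completion P. A \<omega> $ k = 0" for k
  proof -
    have D_nth: "(\<lambda>\<omega>. D \<omega> $ k $ i) \<in> borel_measurable (G t)" for i
      using measurable_G_compose2[where h = "\<lambda>d _. d $ k $ i", OF _ D D] t by simp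
    have X_nth: "(\<lambda>\<omega>. X (Suc t) \<omega> $ i) \<in> borel_measurable (G (Suc t))" for i
      using measurable_G_compose2[where h = "\<lambda>x _. x $ i", OF _ X_measurable_G[OF order_refl] X_measurable_G[OF order_refl]]
        t by simp
    have DX: "(\<lambda>\<omega>. D \<omega> $ k $ i * X (Suc t) \<omega> $ i) \<in> borel_measurable (G (Suc t))" for i
      using G_mono[OF D_nth] X_nth by (rule borel_measurable_times)
    \<comment> \<open>Row \<open>k\<close> of the hypothesis says \<open>?S = ?R\<close>.
      Conditioning \<open>?S\<close> pulls out the entries of \<open>D\<close> and gives row
      \<open>k\<close> of \<open>D\<close> times \<open>cond_X t\<close>, while \<open>?R\<close> is
      its own conditional expectation; comparing the two leaves
      \<open>A \<omega> $ k = 0\<close>.\<close>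
    let ?S = "\<lambda>\<omega>. \<Sum>i\<in>UNIV. D \<omega> $ k $ i * X (Suc t) \<omega> $ i"
    let ?R = "\<lambda>\<omega>. (D \<omega> *v cond_X t \<omega>) $ k - A \<omega> $ k"
    have R: "?R \<in> borel_measurable (G t)"
      using measurable_G_compose2[where h = "\<lambda>x a. x - a $ k", OF _
          measurable_G_compose2[where h = "\<lambda>d c. (d *v c) $ k", OF _ D cond_X_measurable] A]
        t by simp
    have int_DX: "integrable (completion P) (\<lambda>\<omega>. D \<omega> $ k $ i * X (Suc t) \<omega> $ i)" for i
      using integrable[OF _ DX] t by simp
    have "AE \<omega> in completion P. real_cond_exp (completion P) (G t) ?S \<omega> =
        (\<Sum>i\<in>UNIV. real_cond_exp (completion P) (G t) (\<lambda>\<omega>. D \<omega> $ k $ i * X (Suc t) \<omega> $ i) \<omega>)"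
      using int_DX by (rule CE.real_cond_exp_sum)
    moreover have "AE \<omega> in completion P. \<forall>i.
        real_cond_exp (completion P) (G t) (\<lambda>\<omega>. D \<omega> $ k $ i * X (Suc t) \<omega> $ i) \<omega> =
        D \<omega> $ k $ i * cond_X t \<omega> $ i"
      unfolding AE_all_countable cond_X_def vec_lambda_beta
      using D_nth int_DX measurable_G_completion[OF _ X_nth] t
      by (intro allI CE.real_cond_exp_mult) auto
    moreover have "AE \<omega> in completion P. ?S \<omega> = ?R \<omega>"
      using AE_completion[OF ae]
    proof eventually_elim
      case (elim \<omega>)
      then have "D \<omega> *v X (Suc t) \<omega> = D \<omega> *v cond_X t \<omega> - A \<omega>"
        by (simp add: mart_diff_Suc matrix_vector_mult_diff_distrib algebra_simps)
      then have "(D \<omega> *v X (Suc t) \<omega>) $ k = ?R \<omega>"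
        by simp
      then show ?case
        by (simp add: matrix_vector_mult_def)
    qed
    then have "AE \<omega> in completion P. real_cond_exp (completion P) (G t) ?S \<omega> =
        real_cond_exp (completion P) (G t) ?R \<omega>"
      using int_DX measurable_G_completion[OF _ R] t
      by (intro CE.real_cond_exp_cong) auto
    moreover have "AE \<omega> in completion P. real_cond_exp (completion P) (G t) ?R \<omega> = ?R \<omega>"
      using integrable[OF _ R] R t by (intro CE.real_cond_exp_F_meas) auto
    ultimately show ?thesis
      by eventually_elim (simp add: matrix_vector_mult_def)
  qed
  then have "AE \<omega> in P. \<forall>k. A \<omega> $ k = 0"
    by (simp add: AE_all_countable AE_completion_iff)
  then show ?thesis
    by eventually_elim (simp add: vec_eq_iff)
qed

end

section \<open>Reduction of the summed equation to single time steps\<close>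

lemma bsde_solution_iff_step:
  "bsde_solution P X T F Q Y Z \<longleftrightarrow>
     adapted_proc P X T Y \<and> adapted_proc P X T Z \<and> (AE \<omega> in P. Y T \<omega> = Q \<omega>) \<and>
     (\<forall>t<T. AE \<omega> in P.
        Y t \<omega> - F \<omega> t (Y t \<omega>) (Z t \<omega>) + Z t \<omega> *v mart_diff P X (t + 1) \<omega> = Y (Suc t) \<omega>)"
proof -
  let ?eq = "\<lambda>t \<omega>. Y t \<omega> - (\<Sum>u\<in>{t..<T}. F \<omega> u (Y u \<omega>) (Z u \<omega>))
              + (\<Sum>u\<in>{t..<T}. Z u \<omega> *v mart_diff P X (u + 1) \<omega>) = Q \<omega>"
  let ?step = "\<lambda>t \<omega>. Y t \<omega> - F \<omega> t (Y t \<omega>) (Z t \<omega>) + Z t \<omega> *v mart_diff P X (t + 1) \<omega> = Y (Suc t) \<omega>"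
  have eq_iff_step: "?eq t \<omega> \<longleftrightarrow> ?step t \<omega>" if "t < T" "?eq (Suc t) \<omega>" for t \<omega>
  proof -
    \<comment> \<open>The tail \<open>?d\<close> is common to the equations at \<open>t\<close> and
      \<open>Suc t\<close>. The equation at \<open>Suc t\<close> expresses \<open>Q\<close> as
      \<open>Y (Suc t)\<close> plus this tail, so cancelling it leaves the one-step
      relation.\<close>
    let ?d = "(\<Sum>u\<in>{Suc t..<T}. Z u \<omega> *v mart_diff P X (u + 1) \<omega>) - (\<Sum>u\<in>{Suc t..<T}. F \<omega> u (Y u \<omega>) (Z u \<omega>))"
    have "Y t \<omega> - (\<Sum>u\<in>{t..<T}. F \<omega> u (Y u \<omega>) (Z u \<omega>))
          + (\<Sum>u\<in>{t..<T}. Z u \<omega> *v mart_diff P X (u + 1) \<omega>) =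
        (Y t \<omega> - F \<omega> t (Y t \<omega>) (Z t \<omega>) + Z t \<omega> *v mart_diff P X (t + 1) \<omega>) + ?d"
      using that(1) by (simp add: sum.atLeast_Suc_lessThan)
    moreover have "Q \<omega> = Y (Suc t) \<omega> + ?d"
      unfolding that(2)[symmetric] by simp
    ultimately show ?thesis
      by (simp only: add_right_cancel)
  qed
  have "(\<forall>t\<le>T. AE \<omega> in P. ?eq t \<omega>) \<longleftrightarrow>
      (AE \<omega> in P. Y T \<omega> = Q \<omega>) \<and> (\<forall>t<T. AE \<omega> in P. ?step t \<omega>)" (is "?L \<longleftrightarrow> ?R")
  proof
    assume L: ?L
    have "AE \<omega> in P. ?step t \<omega>" if "t < T" for t
    proof -
      have "AE \<omega> in P. ?eq t \<omega>" "AE \<omega> in P. ?eq (Suc t) \<omega>"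
        using L that by auto
      then show ?thesis
        by eventually_elim (use eq_iff_step[OF that] in blast)
    qed
    moreover have "AE \<omega> in P. Y T \<omega> = Q \<omega>"
      using L[rule_format, of T] by simp
    ultimately show ?R by blast
  next
    assume R: ?R
    \<comment> \<open>The sums are rebuilt downwards from \<open>T\<close>, where they are empty and
      the equation is the terminal condition.\<close>
    show ?L
    proof (intro allI impI)
      fix t assume "t \<le> T"
      then show "AE \<omega> in P. ?eq t \<omega>"
      proof (induction rule: inc_induct)
        case base
        then show ?case using R by simp
      next
        case (step t)
        then have "AE \<omega> in P. ?step t \<omega>"
          using R by blast
        with step.IH show ?case
          by eventually_elim (use eq_iff_step step.hyps in blast)
      qed
    qed
  qed
  then show ?thesis
    unfolding bsde_solution_def by blast
qed

section \<open>Existence and uniqueness by backward induction\<close>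

locale basis_bsde = basis_process P T X
  for P :: "'w measure" and T and X :: "nat \<Rightarrow> 'w \<Rightarrow> real ^ 'n" +
  fixes F :: "'w \<Rightarrow> nat \<Rightarrow> real ^ 'k \<Rightarrow> real ^ 'n ^ 'k \<Rightarrow> real ^ 'k"
  assumes F_driver: "driver P X T F"
    and F_equiv_M: "\<And>Y Z1 Z2 t. adapted_proc P X T Y \<Longrightarrow> adapted_proc P X T Z1 \<Longrightarrow>
           adapted_proc P X T Z2 \<Longrightarrow> equiv_M P X T Z1 Z2 \<Longrightarrow> t < T \<Longrightarrow>
           AE \<omega> in P. F \<omega> t (Y t \<omega>) (Z1 t \<omega>) = F \<omega> t (Y t \<omega>) (Z2 t \<omega>)"
    and F_bij: "\<And>Z t. adapted_proc P X T Z \<Longrightarrow> t < T \<Longrightarrow>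
           bij_up_to_ae P (borel_measurable (hist_filtration P X t))
             (\<lambda>y \<omega>. y \<omega> - F \<omega> t (y \<omega>) (Z t \<omega>))"
begin

lemma adapted_iff:
  fixes V :: "nat \<Rightarrow> 'w \<Rightarrow> 'b :: euclidean_space"
  shows "adapted_proc P X T V \<longleftrightarrow> (\<forall>t\<le>T. V t \<in> borel_measurable (G t))"
  by (simp add: adapted_proc_def Linf_eq_measurable)

lemma minus_F_measurable:
  assumes "t \<le> T" "y \<in> borel_measurable (G t)" "z \<in> borel_measurable (G t)"
  shows "(\<lambda>\<omega>. y \<omega> - F \<omega> t (y \<omega>) (z \<omega>)) \<in> borel_measurable (G t)"
proof -
  have "(\<lambda>\<omega>. F \<omega> t (y \<omega>) (z \<omega>)) \<in> borel_measurable (G t)"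
    using F_driver assms by (simp add: driver_def Linf_eq_measurable)
  with assms(2) show ?thesis
    by (rule borel_measurable_diff)
qed

lemma backward_step_exists:
  assumes t: "t < T" and W: "W \<in> borel_measurable (G (Suc t))"
  obtains y z where "y \<in> borel_measurable (G t)" "z \<in> borel_measurable (G t)"
    "AE \<omega> in P. y \<omega> - F \<omega> t (y \<omega>) (z \<omega>) + z \<omega> *v mart_diff P X (t + 1) \<omega> = W \<omega>"
proof -
  obtain H :: "'w \<Rightarrow> real ^ 'n ^ 'k"
    where H: "H \<in> borel_measurable (G t)" "AE \<omega> in P. W \<omega> = H \<omega> *v X (Suc t) \<omega>"
    using measurable_G_Suc_linear[OF _ W] t by auto
  \<comment> \<open>\<open>F_bij\<close> speaks of whole adapted processes, so \<open>H\<close> is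
    placed at time \<open>t\<close> and extended by zero.\<close>
  define Z where "Z s = (if s = t then H else (\<lambda>_. 0))" for s
  have Z: "adapted_proc P X T Z"
    using H(1) by (simp add: adapted_iff Z_def)
  \<comment> \<open>This is the part of \<open>W\<close> known at time \<open>t\<close>, and
    surjectivity is applied to it. The rest of \<open>W\<close> is exactly \<open>H\<close> times
    the martingale difference.\<close>
  have "(\<lambda>\<omega>. H \<omega> *v cond_X t \<omega>) \<in> borel_measurable (G t)"
    using measurable_G_compose2[where h = "(*v)", OF _ H(1) cond_X_measurable] t by simp
  then obtain y where y: "y \<in> borel_measurable (G t)"
    "AE \<omega> in P. y \<omega> - F \<omega> t (y \<omega>) (H \<omega>) = H \<omega> *v cond_X t \<omega>"
    using bij_up_to_ae_surj[OF F_bij[OF Z t]] by (auto simp: Z_def)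
  have "AE \<omega> in P. y \<omega> - F \<omega> t (y \<omega>) (H \<omega>) + H \<omega> *v mart_diff P X (t + 1) \<omega> = W \<omega>"
    using y(2) H(2)
    by eventually_elim (simp add: mart_diff_Suc matrix_vector_mult_diff_distrib)
  with y(1) H(1) show thesis
    by (rule that)
qed

lemma solution_exists:
  assumes Q: "Q \<in> borel_measurable (G T)"
  shows "\<exists>Y Z. bsde_solution P X T F Q Y Z"
proof -
  \<comment> \<open>The induction lowers \<open>s\<close> from \<open>T\<close> to \<open>0\<close>,
    with the step relations holding from \<open>s\<close> onwards. Values before that are
    placeholders: the base case takes zero there, and each induction step overwrites only time
    \<open>s\<close>.\<close>
  have "\<exists>Y Z. adapted_proc P X T Y \<and> adapted_proc P X T Z \<and> Y T = Q \<and>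
      (\<forall>t<T. s \<le> t \<longrightarrow> (AE \<omega> in P.
        Y t \<omega> - F \<omega> t (Y t \<omega>) (Z t \<omega>) + Z t \<omega> *v mart_diff P X (t + 1) \<omega> = Y (Suc t) \<omega>))"
    if "s \<le> T" for s
    using that
  proof (induction rule: inc_induct)
    case base
    show ?case
      using Q by (intro exI[of _ "\<lambda>t. if t = T then Q else (\<lambda>_. 0)"] exI[of _ "\<lambda>_ _. 0"])
        (simp add: adapted_iff)
  next
    case (step s)
    then obtain Y Z where YZ: "adapted_proc P X T Y" "adapted_proc P X T Z" "Y T = Q"
      "\<And>t. t < T \<Longrightarrow> Suc s \<le> t \<Longrightarrow> AE \<omega> in P.
        Y t \<omega> - F \<omega> t (Y t \<omega>) (Z t \<omega>) + Z t \<omega> *v mart_diff P X (t + 1) \<omega> = Y (Suc t) \<omega>"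
      by blast
    have "Y (Suc s) \<in> borel_measurable (G (Suc s))"
      using YZ(1) step.hyps by (simp add: adapted_iff)
    then obtain y z where yz: "y \<in> borel_measurable (G s)" "z \<in> borel_measurable (G s)"
      "AE \<omega> in P. y \<omega> - F \<omega> s (y \<omega>) (z \<omega>) + z \<omega> *v mart_diff P X (s + 1) \<omega> = Y (Suc s) \<omega>"
      using backward_step_exists step.hyps by blast
    show ?case
    proof (intro exI conjI allI impI)
      show "adapted_proc P X T (Y(s := y))" "adapted_proc P X T (Z(s := z))"
        using YZ(1,2) yz(1,2) by (simp_all add: adapted_iff)
      show "(Y(s := y)) T = Q"
        using YZ(3) step.hyps by simp
      \<comment> \<open>At \<open>t = s\<close> this is the new step, since \<open>Y (Suc s)\<close>
        was left unchanged; for later \<open>t\<close> neither \<open>t\<close> nor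
        \<open>Suc t\<close> equals \<open>s\<close>.\<close>
      show "AE \<omega> in P. (Y(s := y)) t \<omega> - F \<omega> t ((Y(s := y)) t \<omega>) ((Z(s := z)) t \<omega>)
          + (Z(s := z)) t \<omega> *v mart_diff P X (t + 1) \<omega> = (Y(s := y)) (Suc t) \<omega>"
        if "t < T" "s \<le> t" for t
        using yz(3) YZ(4)[of t] that by (cases "t = s") auto
    qed
  qed
  from this[of 0] show ?thesis
    by (auto simp: bsde_solution_iff_step)
qed

text \<open>The order of the conclusions matters. Separation first yields equality of the
  \<open>Z\<close> terms; invariance of \<open>F\<close> under equivalence then allows
  \<open>Z1 t\<close> to be replaced by \<open>Z2 t\<close> in the driver; only now do both sides
  involve the same map, whose injectivity gives \<open>Y1 t = Y2 t\<close>.\<close>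

lemma backward_step_unique:
  assumes t: "t < T"
    and Y: "adapted_proc P X T Y1" "adapted_proc P X T Y2"
    and Z: "adapted_proc P X T Z1" "adapted_proc P X T Z2"
    and ae: "AE \<omega> in P.
        Y1 t \<omega> - F \<omega> t (Y1 t \<omega>) (Z1 t \<omega>) + Z1 t \<omega> *v mart_diff P X (t + 1) \<omega> =
        Y2 t \<omega> - F \<omega> t (Y2 t \<omega>) (Z2 t \<omega>) + Z2 t \<omega> *v mart_diff P X (t + 1) \<omega>"
  shows "AE \<omega> in P. Y1 t \<omega> = Y2 t \<omega>"
    and "AE \<omega> in P. Z1 t \<omega> *v mart_diff P X (t + 1) \<omega> = Z2 t \<omega> *v mart_diff P X (t + 1) \<omega>"
proof -
  let ?A = "\<lambda>\<omega>. (Y1 t \<omega> - F \<omega> t (Y1 t \<omega>) (Z1 t \<omega>)) - (Y2 t \<omega> - F \<omega> t (Y2 t \<omega>) (Z2 t \<omega>))"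
  let ?D = "\<lambda>\<omega>. Z1 t \<omega> - Z2 t \<omega>"
  have meas: "Y1 t \<in> borel_measurable (G t)" "Y2 t \<in> borel_measurable (G t)"
      "Z1 t \<in> borel_measurable (G t)" "Z2 t \<in> borel_measurable (G t)"
    using Y Z t by (simp_all add: adapted_iff)
  have A: "AE \<omega> in P. ?A \<omega> = 0"
  proof (rule mart_diff_separation[OF t])
    show "?A \<in> borel_measurable (G t)"
      using meas t by (intro borel_measurable_diff minus_F_measurable) auto
    show "?D \<in> borel_measurable (G t)"
      using meas by (intro borel_measurable_diff)
    show "AE \<omega> in P. ?A \<omega> + ?D \<omega> *v mart_diff P X (t + 1) \<omega> = 0"
      using ae by eventually_elim (simp add: matrix_vector_mult_diff_rdistrib algebra_simps)
  qed
  show ZM: "AE \<omega> in P. Z1 t \<omega> *v mart_diff P X (t + 1) \<omega> = Z2 t \<omega> *v mart_diff P X (t + 1) \<omega>"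
    using ae A by eventually_elim simp
  \<comment> \<open>Agreement of the \<open>Z\<close> terms is known at time \<open>t\<close> only,
    whereas \<open>equiv_M\<close> concerns all times. Changing \<open>Z1\<close> at
    \<open>t\<close> alone produces a process equivalent to \<open>Z1\<close> whose value at
    \<open>t\<close> is \<open>Z2 t\<close>.\<close>
  have "adapted_proc P X T (Z1(t := Z2 t))" "equiv_M P X T Z1 (Z1(t := Z2 t))"
    using Z ZM by (auto simp: adapted_iff equiv_M_def)
  from F_equiv_M[OF Y(1) Z(1) this t]
  have "AE \<omega> in P. F \<omega> t (Y1 t \<omega>) (Z1 t \<omega>) = F \<omega> t (Y1 t \<omega>) (Z2 t \<omega>)"
    by simp
  with A have eq: "AE \<omega> in P. Y1 t \<omega> - F \<omega> t (Y1 t \<omega>) (Z2 t \<omega>) = Y2 t \<omega> - F \<omega> t (Y2 t \<omega>) (Z2 t \<omega>)"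
    by eventually_elim simp
  show "AE \<omega> in P. Y1 t \<omega> = Y2 t \<omega>"
  proof (rule bij_up_to_ae_inj[OF F_bij[OF Z(2) t] _ _ meas(1,2) eq])
    show "(\<lambda>\<omega>. U \<omega> - F \<omega> t (U \<omega>) (Z2 t \<omega>)) \<in> borel_measurable (G t)"
      if "U \<in> borel_measurable (G t)" for U
      using minus_F_measurable that meas(4) t by simp
    show "AE \<omega> in P. U \<omega> - F \<omega> t (U \<omega>) (Z2 t \<omega>) = V \<omega> - F \<omega> t (V \<omega>) (Z2 t \<omega>)"
      if "AE \<omega> in P. U \<omega> = V \<omega>" for U V
      using that by eventually_elim simp
  qed
qed

text \<open>Both solutions start from \<open>Q\<close> at time \<open>T\<close>. Equality at
  \<open>Suc t\<close> equates the left sides of the two one-step relations, and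
  \<open>backward_step_unique\<close> carries it to \<open>t\<close>.\<close>

lemma solution_unique:
  assumes "bsde_solution P X T F Q Y1 Z1" "bsde_solution P X T F Q Y2 Z2"
  shows "AE \<omega> in P. \<forall>t\<le>T. Y1 t \<omega> = Y2 t \<omega>" "equiv_M P X T Z1 Z2"
proof -
  note sol = assms[unfolded bsde_solution_iff_step]
  have adapted: "adapted_proc P X T Y1" "adapted_proc P X T Y2"
      "adapted_proc P X T Z1" "adapted_proc P X T Z2"
    using sol by blast+
  note step_unique = backward_step_unique[OF _ adapted]
  have ae: "AE \<omega> in P.
        Y1 t \<omega> - F \<omega> t (Y1 t \<omega>) (Z1 t \<omega>) + Z1 t \<omega> *v mart_diff P X (t + 1) \<omega> =
        Y2 t \<omega> - F \<omega> t (Y2 t \<omega>) (Z2 t \<omega>) + Z2 t \<omega> *v mart_diff P X (t + 1) \<omega>"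
    if "t < T" "AE \<omega> in P. Y1 (Suc t) \<omega> = Y2 (Suc t) \<omega>" for t
  proof -
    have "AE \<omega> in P. Y1 t \<omega> - F \<omega> t (Y1 t \<omega>) (Z1 t \<omega>) + Z1 t \<omega> *v mart_diff P X (t + 1) \<omega> = Y1 (Suc t) \<omega>"
      "AE \<omega> in P. Y2 t \<omega> - F \<omega> t (Y2 t \<omega>) (Z2 t \<omega>) + Z2 t \<omega> *v mart_diff P X (t + 1) \<omega> = Y2 (Suc t) \<omega>"
      using sol that(1) by blast+
    with that(2) show ?thesis
      by eventually_elim simp
  qed
  have Y: "AE \<omega> in P. Y1 t \<omega> = Y2 t \<omega>" if "t \<le> T" for t
    using that
  proof (induction rule: inc_induct)
    case base
    have "AE \<omega> in P. Y1 T \<omega> = Q \<omega>" "AE \<omega> in P. Y2 T \<omega> = Q \<omega>"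
      using sol by blast+
    then show ?case by eventually_elim simp
  next
    case (step t)
    show ?case
      using step_unique(1) ae step.hyps(2) step.IH by blast
  qed
  \<comment> \<open>Finitely many times contribute finitely many null sets, so equality at each time
    upgrades to indistinguishability.\<close>
  then have "AE \<omega> in P. \<forall>t\<in>{..T}. Y1 t \<omega> = Y2 t \<omega>"
    by (simp add: AE_ball_countable)
  then show "AE \<omega> in P. \<forall>t\<le>T. Y1 t \<omega> = Y2 t \<omega>"
    by eventually_elim simp
  show "equiv_M P X T Z1 Z2"
    unfolding equiv_M_def
  proof (intro allI impI)
    fix t assume t: "t < T"
    then have "AE \<omega> in P. Y1 (Suc t) \<omega> = Y2 (Suc t) \<omega>"
      using Y by simp
    with t show "AE \<omega> in P. Z1 t \<omega> *v mart_diff P X (t + 1) \<omega> = Z2 t \<omega> *v mart_diff P X (t + 1) \<omega>"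
      using step_unique(2) ae by blast
  qed
qed

end

theorem theorem3p2:
  fixes P :: "'w measure"
    and T :: nat
    and X :: "nat \<Rightarrow> 'w \<Rightarrow> real ^ 'n"
    and F :: "'w \<Rightarrow> nat \<Rightarrow> real ^ 'k \<Rightarrow> real ^ 'n ^ 'k \<Rightarrow> real ^ 'k"
    and Q :: "'w \<Rightarrow> real ^ 'k"
  assumes "prob_space P"
    and "T \<ge> 1"
    and "\<And>t. t \<le> T \<Longrightarrow> X t \<in> borel_measurable P"
    and "\<And>t \<omega>. t \<le> T \<Longrightarrow> \<omega> \<in> space P \<Longrightarrow> X t \<omega> \<in> range (\<lambda>i. axis i 1)"
    and "driver P X T F"
    and "\<And>Y Z1 Z2. adapted_proc P X T Y \<Longrightarrow> adapted_proc P X T Z1 \<Longrightarrow> adapted_proc P X T Z2 \<Longrightarrow>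
           equiv_M P X T Z1 Z2 \<Longrightarrow>
           (\<forall>t<T. AE \<omega> in P. F \<omega> t (Y t \<omega>) (Z1 t \<omega>) = F \<omega> t (Y t \<omega>) (Z2 t \<omega>))"
    and "\<And>Z t. adapted_proc P X T Z \<Longrightarrow> t < T \<Longrightarrow>
           bij_up_to_ae P (borel_measurable (hist_filtration P X t))
             (\<lambda>y \<omega>. y \<omega> - F \<omega> t (y \<omega>) (Z t \<omega>))"
    and "Q \<in> Linf P (hist_filtration P X T)"
  shows "(\<exists>Y Z. bsde_solution P X T F Q Y Z) \<and>
         (\<forall>Y1 Z1 Y2 Z2.
            bsde_solution P X T F Q Y1 Z1 \<longrightarrow> bsde_solution P X T F Q Y2 Z2 \<longrightarrow>
            (AE \<omega> in P. \<forall>t\<le>T. Y1 t \<omega> = Y2 t \<omega>) \<and> equiv_M P X T Z1 Z2)"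
proof -
  interpret basis_process P T X
    using assms(1,3,4) by (simp add: basis_process_def basis_process_axioms_def)
  interpret basis_bsde P T X F
    using assms(5-7) by unfold_locales blast+
  have "Q \<in> borel_measurable (hist_filtration P X T)"
    using assms(8) by (simp add: Linf_def)
  then show ?thesis
    using solution_exists solution_unique by blast
qed

end
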